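(* Let $\mathscr{F}$ be a fragment of first-order logic and let $\mathbb{S}$ be a structural signature. Then $\mathscr{F}(\mathbb{S})\circ\mathsf{MOD}=\mathscr{F}(\mathbb{S},\mathbf{MOD})$.
   Context: Words $w\in A^*$ are logical structures with domain $\{0,\dots,|w|-1\}$. A predicate of arity $k$ has a fixed interpretation as a $k$-ary relation on positions of each word; it is structural if its interpretation is defined for every alphabet and depends only on the length of the word (not on the labels). A signature is structural if all its predicates are. A fragment $\mathscr{F}$ of first-order logic consists of a set of variables $V_{\mathscr{F}}$ and, for every signature $\mathbb{S}$, a set $\mathscr{F}[\mathbb{S}]$ of first-order formulas over $\mathbb{S}$ using only variables in $V_{\mathscr{F}}$, such that: every quantifier-free formula over $\mathbb{S}$ is in $\mathscr{F}[\mathbb{S}]$; $\mathscr{F}[\mathbb{S}]$ is closed under conjunction and disjunction; and if $\varphi\in\mathscr{F}[\mathbb{S}]$, then $\mathscr{F}[\mathbb{S}']$ contains every formula obtained from $\varphi$ by replacing each atomic formula by a quantifier-free formula of $\mathscr{F}[\mathbb{S}']$. For a structural signature $\mathbb{S}$, $\mathscr{F}(\mathbb{S})(A)$ is the set of languages over $A$ defined by sentences of $\mathscr{F}[A\cup\mathbb{S}]$, where $A$ denotes the label predicates $a(x)$ ($a\in A$). The modular predicates $\mathbf{MOD}$ are, for all $d>1$ and $0\le i<d$, the unary $\mathbf{MOD}^d_i(x)$ (true when $x\equiv i\bmod d$) and the constant $\mathbf{D}^d_i$ (true when $|w|\equiv i\bmod d$); $\mathscr{F}(\mathbb{S},\mathbf{MOD})$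 denotes $\mathscr{F}(\mathbb{S}\cup\mathbf{MOD})$. Enrichment: for a finite partition $\mathbf{P}$ of $A^*$, $[u]_{\mathbf{P}}$ is the block containing $u$; $\tau_{\mathbf{P}}:A^*\to(\mathbf{P}\times A)^*$ maps $a_1\cdots a_n$ to $b_1\cdots b_n$ with $b_i=([a_1\cdots a_{i-1}]_{\mathbf{P}},a_i)$, $\tau_{\mathbf{P}}(\varepsilon)=\varepsilon$. For classes $\mathscr{C},\mathscr{D}$, $(\mathscr{C}\circ\mathscr{D})(A)$ is the set of $L\subseteq A^*$ such that for some finite partition $\mathbf{P}$ of $A^*$ into languages of $\mathscr{D}(A)$ there are $L_P\in\mathscr{C}(\mathbf{P}\times A)$ ($P\in\mathbf{P}$) with $L=\bigcup_{P\in\mathbf{P}}(\tau_{\mathbf{P}}^{-1}(L_P)\cap P)$. $\mathsf{MOD}(A)$ is the set of finite Boolean combinations of languages $\{w\in A^*\mid |w|\equiv m\bmod d\}$ ($m<d$). *)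

theory Defs
  imports Complex_Main "HOL-Library.Countable_Set_Type" "HOL-Library.Disjoint_Sets"
begin

(* A universe of letters closed under passing from an alphabet A to the product of A with a set
   of languages over A. Alphabets are the finite subsets of this type, so that a class of languages
   can be applied both to A and to its enrichments. Languages over finite alphabets are countable,
   hence recursion through cset suffices. *)
datatype 'a letter = Base 'a | Tagged "'a letter list cset" "'a letter"

type_synonym 'a word = "'a letter list"
type_synonym 'a lang = "'a word set"
type_synonym 'a lang_class = "'a letter set \<Rightarrow> 'a lang set"

(* The letter (B, a); meaningful for countable B only, see tag_inject. *)
definition tag :: "'a lang \<Rightarrow> 'a letter \<Rightarrow> 'a letter" where
  "tag B a = Tagged (acset B) a"

lemma tag_inject:
  "countable B \<Longrightarrow> countable C \<Longrightarrow> tag B a = tag C b \<longleftrightarrow> B = C \<and> a = b"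
  by (auto simp: tag_def acset_inject)

lemma countable_lang: "finite A \<Longrightarrow> B \<subseteq> lists A \<Longrightarrow> countable B"
  by (meson countable_finite countable_lists countable_subset)


section \<open>Predicates and first-order formulas on words\<close>

(* Predicate symbols. "Other n k R" is the symbol named n, of arity k, interpreted by R. *)
datatype ('a, 'p) pred =
    Label "'a letter"
  | ModPos nat nat
  | ModLen nat nat
  | Other 'p nat "'a word \<Rightarrow> nat list \<Rightarrow> bool"

primrec arity :: "('a, 'p) pred \<Rightarrow> nat" where
  "arity (Label a) = 1"
| "arity (ModPos d i) = 1"
| "arity (ModLen d i) = 0"
| "arity (Other n k R) = k"

(* Only relevant on argument lists xs of length arity p whose entries are positions of w. *)
primrec holds :: "('a, 'p) pred \<Rightarrow> 'a word \<Rightarrow> nat list \<Rightarrow> bool" where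
  "holds (Label a) w xs \<longleftrightarrow> w ! hd xs = a"
| "holds (ModPos d i) w xs \<longleftrightarrow> hd xs mod d = i"
| "holds (ModLen d i) w xs \<longleftrightarrow> length w mod d = i"
| "holds (Other n k R) w xs \<longleftrightarrow> R w xs"

definition structural :: "('a, 'p) pred \<Rightarrow> bool" where
  "structural p \<longleftrightarrow>
     (\<forall>u v xs. length u = length v \<longrightarrow> length xs = arity p \<longrightarrow> set xs \<subseteq> {..<length u} \<longrightarrow>
        holds p u xs = holds p v xs)"

definition structural_sig :: "('a, 'p) pred set \<Rightarrow> bool" where
  "structural_sig S \<longleftrightarrow> (\<forall>p\<in>S. structural p)"

definition MOD_sig :: "('a, 'p) pred set" where
  "MOD_sig = {ModPos d i | d i. d > 1 \<and> i < d} \<union> {ModLen d i | d i. d > 1 \<and> i < d}"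

(* There is no built-in equality: it is a structural predicate which a signature may contain. *)
datatype ('a, 'p) fm =
    TT
  | FF
  | Atom "('a, 'p) pred" "nat list"
  | Neg "('a, 'p) fm"
  | And "('a, 'p) fm" "('a, 'p) fm"
  | Or "('a, 'p) fm" "('a, 'p) fm"
  | Ex nat "('a, 'p) fm"
  | All nat "('a, 'p) fm"

primrec sat :: "'a word \<Rightarrow> (nat \<Rightarrow> nat) \<Rightarrow> ('a, 'p) fm \<Rightarrow> bool" where
  "sat w e TT \<longleftrightarrow> True"
| "sat w e FF \<longleftrightarrow> False"
| "sat w e (Atom p xs) \<longleftrightarrow> holds p w (map e xs)"
| "sat w e (Neg \<phi>) \<longleftrightarrow> \<not> sat w e \<phi>"
| "sat w e (And \<phi> \<psi>) \<longleftrightarrow> sat w e \<phi> \<and> sat w e \<psi>"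
| "sat w e (Or \<phi> \<psi>) \<longleftrightarrow> sat w e \<phi> \<or> sat w e \<psi>"
| "sat w e (Ex x \<phi>) \<longleftrightarrow> (\<exists>i<length w. sat w (e(x := i)) \<phi>)"
| "sat w e (All x \<phi>) \<longleftrightarrow> (\<forall>i<length w. sat w (e(x := i)) \<phi>)"

primrec vars :: "('a, 'p) fm \<Rightarrow> nat set" where
  "vars TT = {}"
| "vars FF = {}"
| "vars (Atom p xs) = set xs"
| "vars (Neg \<phi>) = vars \<phi>"
| "vars (And \<phi> \<psi>) = vars \<phi> \<union> vars \<psi>"
| "vars (Or \<phi> \<psi>) = vars \<phi> \<union> vars \<psi>"
| "vars (Ex x \<phi>) = insert x (vars \<phi>)"
| "vars (All x \<phi>) = insert x (vars \<phi>)"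

primrec free_vars :: "('a, 'p) fm \<Rightarrow> nat set" where
  "free_vars TT = {}"
| "free_vars FF = {}"
| "free_vars (Atom p xs) = set xs"
| "free_vars (Neg \<phi>) = free_vars \<phi>"
| "free_vars (And \<phi> \<psi>) = free_vars \<phi> \<union> free_vars \<psi>"
| "free_vars (Or \<phi> \<psi>) = free_vars \<phi> \<union> free_vars \<psi>"
| "free_vars (Ex x \<phi>) = free_vars \<phi> - {x}"
| "free_vars (All x \<phi>) = free_vars \<phi> - {x}"

primrec atoms :: "('a, 'p) fm \<Rightarrow> (('a, 'p) pred \<times> nat list) set" where
  "atoms TT = {}"
| "atoms FF = {}"
| "atoms (Atom p xs) = {(p, xs)}"
| "atoms (Neg \<phi>) = atoms \<phi>"
| "atoms (And \<phi> \<psi>) = atoms \<phi> \<union> atoms \<psi>"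
| "atoms (Or \<phi> \<psi>) = atoms \<phi> \<union> atoms \<psi>"
| "atoms (Ex x \<phi>) = atoms \<phi>"
| "atoms (All x \<phi>) = atoms \<phi>"

primrec quantifier_free :: "('a, 'p) fm \<Rightarrow> bool" where
  "quantifier_free TT \<longleftrightarrow> True"
| "quantifier_free FF \<longleftrightarrow> True"
| "quantifier_free (Atom p xs) \<longleftrightarrow> True"
| "quantifier_free (Neg \<phi>) \<longleftrightarrow> quantifier_free \<phi>"
| "quantifier_free (And \<phi> \<psi>) \<longleftrightarrow> quantifier_free \<phi> \<and> quantifier_free \<psi>"
| "quantifier_free (Or \<phi> \<psi>) \<longleftrightarrow> quantifier_free \<phi> \<and> quantifier_free \<psi>"
| "quantifier_free (Ex x \<phi>) \<longleftrightarrow> False"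
| "quantifier_free (All x \<phi>) \<longleftrightarrow> False"

primrec replace_atoms ::
  "(('a, 'p) pred \<Rightarrow> nat list \<Rightarrow> ('a, 'p) fm) \<Rightarrow> ('a, 'p) fm \<Rightarrow> ('a, 'p) fm" where
  "replace_atoms \<sigma> TT = TT"
| "replace_atoms \<sigma> FF = FF"
| "replace_atoms \<sigma> (Atom p xs) = \<sigma> p xs"
| "replace_atoms \<sigma> (Neg \<phi>) = Neg (replace_atoms \<sigma> \<phi>)"
| "replace_atoms \<sigma> (And \<phi> \<psi>) = And (replace_atoms \<sigma> \<phi>) (replace_atoms \<sigma> \<psi>)"
| "replace_atoms \<sigma> (Or \<phi> \<psi>) = Or (replace_atoms \<sigma> \<phi>) (replace_atoms \<sigma> \<psi>)"
| "replace_atoms \<sigma> (Ex x \<phi>) = Ex x (replace_atoms \<sigma> \<phi>)"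
| "replace_atoms \<sigma> (All x \<phi>) = All x (replace_atoms \<sigma> \<phi>)"

definition formulas :: "nat set \<Rightarrow> ('a, 'p) pred set \<Rightarrow> ('a, 'p) fm set" where
  "formulas V S = {\<phi>. vars \<phi> \<subseteq> V \<and> (\<forall>(p, xs)\<in>atoms \<phi>. p \<in> S \<and> length xs = arity p)}"


section \<open>Fragments of first-order logic\<close>

(* In the last condition, all occurrences of the same atomic formula are replaced by the same
   formula. Closure under independent replacement of occurrences would demand more of F. *)
definition fragment :: "nat set \<Rightarrow> (('a, 'p) pred set \<Rightarrow> ('a, 'p) fm set) \<Rightarrow> bool" where
  "fragment V F \<longleftrightarrow>
     (\<forall>S. F S \<subseteq> formulas V S) \<and>
     (\<forall>S. \<forall>\<phi>\<in>formulas V S. quantifier_free \<phi> \<longrightarrow> \<phi> \<in> F S) \<and>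
     (\<forall>S. \<forall>\<phi>\<in>F S. \<forall>\<psi>\<in>F S. And \<phi> \<psi> \<in> F S \<and> Or \<phi> \<psi> \<in> F S) \<and>
     (\<forall>S S'. \<forall>\<phi>\<in>F S. \<forall>\<sigma>.
        (\<forall>(p, xs)\<in>atoms \<phi>. quantifier_free (\<sigma> p xs) \<and> \<sigma> p xs \<in> F S') \<longrightarrow>
        replace_atoms \<sigma> \<phi> \<in> F S')"

(* Sentences have no free variables, so the choice of the assignment in lang_of is irrelevant. *)
definition lang_of :: "'a letter set \<Rightarrow> ('a, 'p) fm \<Rightarrow> 'a lang" where
  "lang_of A \<phi> = {w \<in> lists A. sat w (\<lambda>_. 0) \<phi>}"

definition fragment_class ::
  "(('a, 'p) pred set \<Rightarrow> ('a, 'p) fm set) \<Rightarrow> ('a, 'p) pred set \<Rightarrow> 'a lang_class" where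
  "fragment_class F S A = {lang_of A \<phi> | \<phi>. \<phi> \<in> F (Label ` A \<union> S) \<and> free_vars \<phi> = {}}"


section \<open>Enrichment\<close>

definition block :: "'a lang set \<Rightarrow> 'a word \<Rightarrow> 'a lang" where
  "block P u = (THE B. B \<in> P \<and> u \<in> B)"

definition enrich_word :: "'a lang set \<Rightarrow> 'a word \<Rightarrow> 'a word" where
  "enrich_word P w = map (\<lambda>i. tag (block P (take i w)) (w ! i)) [0..<length w]"

definition enrich_alphabet :: "'a lang set \<Rightarrow> 'a letter set \<Rightarrow> 'a letter set" where
  "enrich_alphabet P A = {tag B a | B a. B \<in> P \<and> a \<in> A}"

definition enrichment :: "'a lang_class \<Rightarrow> 'a lang_class \<Rightarrow> 'a lang_class"  (infixl \<open>\<circ>\<^sub>e\<close> 55) where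
  "(C \<circ>\<^sub>e D) A =
     {L. \<exists>P L'. finite P \<and> partition_on (lists A) P \<and> P \<subseteq> D A \<and>
           (\<forall>B\<in>P. L' B \<in> C (enrich_alphabet P A)) \<and>
           L = (\<Union>B\<in>P. {w \<in> lists A. enrich_word P w \<in> L' B} \<inter> B)}"

inductive_set MOD_class :: "'a letter set \<Rightarrow> 'a lang set" for A :: "'a letter set" where
  basic: "m < d \<Longrightarrow> {w \<in> lists A. length w mod d = m} \<in> MOD_class A"
| compl: "L \<in> MOD_class A \<Longrightarrow> lists A - L \<in> MOD_class A"
| union: "K \<in> MOD_class A \<Longrightarrow> L \<in> MOD_class A \<Longrightarrow> K \<union> L \<in> MOD_class A"
| inter: "K \<in> MOD_class A \<Longrightarrow> L \<in> MOD_class A \<Longrightarrow> K \<inter> L \<in> MOD_class A"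

end

theory Submission
  imports Defs
begin

text \<open>A language in \<^term>\<open>MOD_class A\<close> is given by the residue of the length, so the block of the
  prefix before a position is determined by the residue of that position. Hence a label predicate of
  an enriched alphabet is a quantifier-free combination of labels and modular predicates. Conversely,
  for a common multiple \<open>N\<close> of the moduli occurring in a sentence, enrichment by the length modulo
  \<open>N\<close> turns position predicates into disjunctions of labels, and on each block the length
  predicates are constants. All other predicates are structural, so they do not see the enrichment.\<close>

section \<open>Finite disjunctions\<close>

definition Disj :: "('a, 'p) fm list \<Rightarrow> ('a, 'p) fm" where
  "Disj \<phi>s = foldr Or \<phi>s FF"

lemma sat_Disj [simp]: "sat w e (Disj \<phi>s) \<longleftrightarrow> (\<exists>\<phi>\<in>set \<phi>s. sat w e \<phi>)"
  unfolding Disj_def by (induction \<phi>s) auto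

lemma free_vars_Disj [simp]: "free_vars (Disj \<phi>s) = (\<Union>\<phi>\<in>set \<phi>s. free_vars \<phi>)"
  unfolding Disj_def by (induction \<phi>s) auto

lemma quantifier_free_Disj [simp]:
  "quantifier_free (Disj \<phi>s) \<longleftrightarrow> (\<forall>\<phi>\<in>set \<phi>s. quantifier_free \<phi>)"
  unfolding Disj_def by (induction \<phi>s) auto

lemma formulas_Disj [simp]: "Disj \<phi>s \<in> formulas V S \<longleftrightarrow> set \<phi>s \<subseteq> formulas V S"
  unfolding Disj_def formulas_def by (induction \<phi>s) auto

lemma formulas_simps [simp]:
  "TT \<in> formulas V S" "FF \<in> formulas V S"
  "Atom p xs \<in> formulas V S \<longleftrightarrow> set xs \<subseteq> V \<and> p \<in> S \<and> length xs = arity p"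
  "And \<phi> \<psi> \<in> formulas V S \<longleftrightarrow> \<phi> \<in> formulas V S \<and> \<psi> \<in> formulas V S"
  by (auto simp: formulas_def)

lemma fragment_quantifier_free:
  "fragment V F \<Longrightarrow> \<phi> \<in> formulas V S \<Longrightarrow> quantifier_free \<phi> \<Longrightarrow> \<phi> \<in> F S"
  by (simp add: fragment_def)

lemma fragment_And: "fragment V F \<Longrightarrow> \<phi> \<in> F S \<Longrightarrow> \<psi> \<in> F S \<Longrightarrow> And \<phi> \<psi> \<in> F S"
  by (simp add: fragment_def)

lemma fragment_replace_atoms:
  assumes "fragment V F" "\<phi> \<in> F S"
    and "\<And>p xs. (p, xs) \<in> atoms \<phi> \<Longrightarrow> quantifier_free (\<sigma> p xs) \<and> \<sigma> p xs \<in> F S'"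
  shows "replace_atoms \<sigma> \<phi> \<in> F S'"
proof -
  have "\<forall>(p, xs)\<in>atoms \<phi>. quantifier_free (\<sigma> p xs) \<and> \<sigma> p xs \<in> F S'"
    using assms(3) by blast
  with assms(1,2) show ?thesis unfolding fragment_def by blast
qed

text \<open>Binary closure under \<open>Or\<close> starts from the empty disjunction
  \<open>FF\<close>, which is quantifier-free and has no variables, hence lies in every
  \<open>F S\<close>.\<close>

lemma fragment_Disj:
  assumes "fragment V F" "set \<phi>s \<subseteq> F S"
  shows "Disj \<phi>s \<in> F S"
  using assms(2)
proof (induction \<phi>s)
  case Nil
  then show ?case
    using fragment_quantifier_free[OF assms(1), of FF] by (simp add: Disj_def)
next
  case (Cons \<phi> \<phi>s)
  then have "\<phi> \<in> F S" "Disj \<phi>s \<in> F S" by auto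
  then have "Or \<phi> (Disj \<phi>s) \<in> F S"
    using assms(1) by (simp add: fragment_def)
  then show ?case by (simp add: Disj_def)
qed


section \<open>Translating sentences atom by atom\<close>

lemma finite_atoms: "finite (atoms \<phi>)"
  by (induction \<phi>) auto

lemma vars_atoms: "(p, xs) \<in> atoms \<phi> \<Longrightarrow> set xs \<subseteq> vars \<phi>"
  by (induction \<phi>) auto

lemma free_vars_subset_vars: "free_vars \<phi> \<subseteq> vars \<phi>"
  by (induction \<phi>) auto

lemma free_vars_replace_atoms:
  assumes "\<And>p xs. (p, xs) \<in> atoms \<phi> \<Longrightarrow> free_vars (\<sigma> p xs) \<subseteq> set xs"
  shows "free_vars (replace_atoms \<sigma> \<phi>) \<subseteq> free_vars \<phi>"
  using assms by (induction \<phi>) fastforce+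

text \<open>Atoms have to be translated correctly only under assignments into the positions of the
  word: predicates and labels carry no meaning elsewhere. Quantifiers preserve this restriction
  because they range over positions, and equal lengths make them range over the same positions in
  both words.\<close>

lemma sat_replace_atoms:
  assumes "length u = length w"
    and "\<And>p xs e. (p, xs) \<in> atoms \<phi> \<Longrightarrow> e ` set xs \<subseteq> {..<length w} \<Longrightarrow>
      sat u e (\<sigma> p xs) \<longleftrightarrow> holds p w (map e xs)"
    and "e ` free_vars \<phi> \<subseteq> {..<length w}"
  shows "sat u e (replace_atoms \<sigma> \<phi>) \<longleftrightarrow> sat w e \<phi>"
  using assms(2,3)
proof (induction \<phi> arbitrary: e)
  case (Ex x \<phi>)
  have "sat u (e(x := i)) (replace_atoms \<sigma> \<phi>) \<longleftrightarrow> sat w (e(x := i)) \<phi>" if "i < length w" for i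
    using that Ex.prems by (intro Ex.IH) auto
  then show ?case using assms(1) by auto
next
  case (All x \<phi>)
  have "sat u (e(x := i)) (replace_atoms \<sigma> \<phi>) \<longleftrightarrow> sat w (e(x := i)) \<phi>" if "i < length w" for i
    using that All.prems by (intro All.IH) auto
  then show ?case using assms(1) by auto
next
  case (And \<phi> \<psi>)
  have "sat u e (replace_atoms \<sigma> \<phi>) \<longleftrightarrow> sat w e \<phi>" "sat u e (replace_atoms \<sigma> \<psi>) \<longleftrightarrow> sat w e \<psi>"
    using And.prems by (auto intro!: And.IH)
  then show ?case by simp
next
  case (Or \<phi> \<psi>)
  have "sat u e (replace_atoms \<sigma> \<phi>) \<longleftrightarrow> sat w e \<phi>" "sat u e (replace_atoms \<sigma> \<psi>) \<longleftrightarrow> sat w e \<psi>"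
    using Or.prems by (auto intro!: Or.IH)
  then show ?case by simp
qed auto

text \<open>The pairs \<open>(u, w) \<in> W\<close> relate a word of the target signature to the word of the source
  signature which it encodes; both directions of the theorem use this lemma.\<close>

lemma fragment_translation:
  assumes F: "fragment V F" and \<phi>: "\<phi> \<in> F S" "free_vars \<phi> = {}"
    and len: "\<And>u w. (u, w) \<in> W \<Longrightarrow> length u = length w"
    and ex: "\<And>p xs. p \<in> S \<Longrightarrow> length xs = arity p \<Longrightarrow> (p, xs) \<in> atoms \<phi> \<Longrightarrow>
      \<exists>\<psi>. quantifier_free \<psi> \<and> \<psi> \<in> formulas (set xs) S' \<and>
        (\<forall>(u, w)\<in>W. \<forall>e. e ` set xs \<subseteq> {..<length w} \<longrightarrow>
          sat u e \<psi> = holds p w (map e xs))"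
  shows "\<exists>\<phi>'\<in>F S'. free_vars \<phi>' = {} \<and> (\<forall>(u, w)\<in>W. \<forall>e. sat u e \<phi>' = sat w e \<phi>)"
proof -
  have \<phi>V: "\<phi> \<in> formulas V S"
    using F \<phi>(1) unfolding fragment_def by blast
  have "\<forall>(p, xs)\<in>atoms \<phi>. \<exists>\<psi>. quantifier_free \<psi> \<and> \<psi> \<in> formulas (set xs) S' \<and>
        (\<forall>(u, w)\<in>W. \<forall>e. e ` set xs \<subseteq> {..<length w} \<longrightarrow>
          sat u e \<psi> = holds p w (map e xs))"
    using \<phi>V ex by (fastforce simp: formulas_def)
  then obtain \<sigma> where \<sigma>: "\<And>p xs. (p, xs) \<in> atoms \<phi> \<Longrightarrow>
      quantifier_free (\<sigma> (p, xs)) \<and> \<sigma> (p, xs) \<in> formulas (set xs) S' \<and>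
        (\<forall>(u, w)\<in>W. \<forall>e. e ` set xs \<subseteq> {..<length w} \<longrightarrow>
          sat u e (\<sigma> (p, xs)) = holds p w (map e xs))"
    unfolding case_prod_unfold by (metis fst_conv snd_conv)
  define \<phi>' where "\<phi>' = replace_atoms (curry \<sigma>) \<phi>"
  \<comment> \<open>The substitute of an atom uses no variables beyond those of the atom. These
    occur in \<phi>, so they belong to \<open>V\<close> and the fragment contains the
    substitute.\<close>
  have "\<sigma> (p, xs) \<in> F S'" if "(p, xs) \<in> atoms \<phi>" for p xs
  proof (rule fragment_quantifier_free[OF F])
    show "\<sigma> (p, xs) \<in> formulas V S'"
      using \<sigma>[OF that] vars_atoms[OF that] \<phi>V by (auto simp: formulas_def)
  qed (use \<sigma>[OF that] in blast)
  then have "\<phi>' \<in> F S'"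
    unfolding \<phi>'_def using \<sigma> by (intro fragment_replace_atoms[OF F \<phi>(1)]) auto
  \<comment> \<open>For the same reason no new free variable appears, and the translation of a
    sentence is again a sentence.\<close>
  moreover have "free_vars \<phi>' = {}"
    using free_vars_replace_atoms[of \<phi> "curry \<sigma>"] \<phi>(2) \<sigma> free_vars_subset_vars
    unfolding \<phi>'_def formulas_def by fastforce
  moreover have "sat u e \<phi>' = sat w e \<phi>" if "(u, w) \<in> W" for u w e
    unfolding \<phi>'_def
  proof (rule sat_replace_atoms)
    show "length u = length w" using len[OF that] .
    show "sat u e (curry \<sigma> p xs) \<longleftrightarrow> holds p w (map e xs)"
      if "(p, xs) \<in> atoms \<phi>" "e ` set xs \<subseteq> {..<length w}" for p xs e
      using \<sigma>[OF that(1)] that(2) \<open>(u, w) \<in> W\<close> by auto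
  qed (simp add: \<phi>(2))
  ultimately show ?thesis by blast
qed

lemma structural_holds:
  "structural p \<Longrightarrow> length u = length w \<Longrightarrow> length xs = arity p \<Longrightarrow>
    e ` set xs \<subseteq> {..<length w} \<Longrightarrow> holds p u (map e xs) = holds p w (map e xs)"
  unfolding structural_def by (metis length_map set_map)


section \<open>Enriched words\<close>

lemma block_eq: "partition_on \<Omega> P \<Longrightarrow> B \<in> P \<Longrightarrow> u \<in> B \<Longrightarrow> block P u = B"
  unfolding block_def by (rule the_equality) (auto dest: partition_onD2 disjointD)

lemma block_mem:
  assumes "partition_on \<Omega> P" "u \<in> \<Omega>"
  shows "block P u \<in> P" "u \<in> block P u"
proof -
  obtain B where "B \<in> P" "u \<in> B"
    using assms partition_onD1 by blast
  with block_eq[OF assms(1) this] show "block P u \<in> P" "u \<in> block P u" by auto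
qed

lemma length_enrich_word [simp]: "length (enrich_word P w) = length w"
  by (simp add: enrich_word_def)

lemma enrich_word_nth:
  "i < length w \<Longrightarrow> enrich_word P w ! i = tag (block P (take i w)) (w ! i)"
  by (simp add: enrich_word_def)

lemma take_in_lists: "w \<in> lists A \<Longrightarrow> take i w \<in> lists A"
  by (auto dest: in_set_takeD)

lemma enrich_word_in_lists:
  assumes "partition_on (lists A) P" "w \<in> lists A"
  shows "enrich_word P w \<in> lists (enrich_alphabet P A)"
  using assms block_mem(1)[OF assms(1) take_in_lists[OF assms(2)]]
  by (fastforce simp: enrich_word_def enrich_alphabet_def in_lists_conv_set)

text \<open>Tags are known to be injective only on countable languages. Finiteness of
  \<open>A\<close> makes every block countable, and disjointness of the blocks turns equality of
  blocks into membership of the prefix.\<close>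

lemma enrich_word_nth_eq_tag:
  assumes "finite A" "partition_on (lists A) P" "w \<in> lists A" "B \<in> P" "i < length w"
  shows "enrich_word P w ! i = tag B a \<longleftrightarrow> take i w \<in> B \<and> w ! i = a"
proof -
  have cnt: "countable C" if "C \<in> P" for C
    using countable_lang[OF assms(1)] assms(2) that by (auto dest: partition_onD1)
  note b = block_mem[OF assms(2) take_in_lists[OF assms(3), of i]]
  have "enrich_word P w ! i = tag B a \<longleftrightarrow> block P (take i w) = B \<and> w ! i = a"
    using assms(5) tag_inject[OF cnt[OF b(1)] cnt[OF assms(4)]] by (simp add: enrich_word_nth)
  then show ?thesis
    using b block_eq[OF assms(2,4)] by auto
qed


section \<open>Languages given by the residue of the length\<close>

text \<open>Induction over the Boolean operations: a complement complements the residue set, while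
  union and intersection pass to the product of the two moduli, which determines both residues. The
  bound \<open>d > 1\<close> is what makes the modulus admissible in \<open>MOD_sig\<close>.\<close>

lemma MOD_class_residues:
  assumes "L \<in> MOD_class A"
  shows "\<exists>d R. d > 1 \<and> L = {w \<in> lists A. length w mod d \<in> R}"
  using assms
proof induction
  case (basic m d)
  then show ?case
    \<comment> \<open>A generator may have modulus 1. Doubling the modulus makes it exceed 1 and
      still determines the residue modulo \<open>d\<close>.\<close>
    by (intro exI[of _ "2 * d"] exI[of _ "{r. r mod d = m}"]) (auto simp: mod_mod_cancel)
next
  case (compl L)
  then obtain d R where "d > 1" and L: "L = {w \<in> lists A. length w mod d \<in> R}" by metis
  then show ?case unfolding L by (intro exI[of _ d] exI[of _ "- R"]) auto
next
  case (union K L)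
  obtain c Q where c: "c > 1" and K: "K = {w \<in> lists A. length w mod c \<in> Q}"
    using union.IH(1) by metis
  obtain d R where d: "d > 1" and L: "L = {w \<in> lists A. length w mod d \<in> R}"
    using union.IH(2) by metis
  show ?case unfolding K L using c d less_1_mult[OF c d]
    by (intro exI[of _ "c * d"] exI[of _ "{r. r mod c \<in> Q \<or> r mod d \<in> R}"])
      (auto simp: mod_mod_cancel)
next
  case (inter K L)
  obtain c Q where c: "c > 1" and K: "K = {w \<in> lists A. length w mod c \<in> Q}"
    using inter.IH(1) by metis
  obtain d R where d: "d > 1" and L: "L = {w \<in> lists A. length w mod d \<in> R}"
    using inter.IH(2) by metis
  show ?case unfolding K L using c d less_1_mult[OF c d]
    by (intro exI[of _ "c * d"] exI[of _ "{r. r mod c \<in> Q \<and> r mod d \<in> R}"])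
      (auto simp: mod_mod_cancel)
qed

text \<open>The set \<open>R\<close> may be infinite or contain numbers that are not residues;
  filtering \<open>[0..<d]\<close> keeps the disjunction finite and loses no residue.\<close>

definition pos_residue_fm :: "nat \<Rightarrow> nat set \<Rightarrow> nat list \<Rightarrow> ('a, 'p) fm" where
  "pos_residue_fm d R xs = Disj (map (\<lambda>i. Atom (ModPos d i) xs) (filter (\<lambda>i. i \<in> R) [0..<d]))"

definition len_residue_fm :: "nat \<Rightarrow> nat set \<Rightarrow> ('a, 'p) fm" where
  "len_residue_fm d R = Disj (map (\<lambda>i. Atom (ModLen d i) []) (filter (\<lambda>i. i \<in> R) [0..<d]))"

lemma pos_residue_fm:
  assumes "d > 1"
  shows "sat w e (pos_residue_fm d R [x]) \<longleftrightarrow> e x mod d \<in> R"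
    and "pos_residue_fm d R [x] \<in> formulas {x} (T \<union> MOD_sig)"
    and "quantifier_free (pos_residue_fm d R [x])"
  using assms by (auto simp: pos_residue_fm_def MOD_sig_def)

lemma len_residue_fm:
  assumes "d > 1"
  shows "sat w e (len_residue_fm d R) \<longleftrightarrow> length w mod d \<in> R"
    and "len_residue_fm d R \<in> formulas X (T \<union> MOD_sig)"
    and "quantifier_free (len_residue_fm d R)"
    and "free_vars (len_residue_fm d R) = {}"
  using assms by (auto simp: len_residue_fm_def MOD_sig_def)

section \<open>Expressing the enrichment by modular predicates\<close>

lemma enrichment_subset:
  fixes F :: "('a, 'p) pred set \<Rightarrow> ('a, 'p) fm set"
  assumes F: "fragment V F" and S: "structural_sig S" and A: "finite A"
  shows "(fragment_class F S \<circ>\<^sub>e MOD_class) A \<subseteq> fragment_class F (S \<union> MOD_sig) A"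
proof
  fix L assume "L \<in> (fragment_class F S \<circ>\<^sub>e MOD_class) A"
  then obtain P L' where P: "finite P" "partition_on (lists A) P" "P \<subseteq> MOD_class A"
    and L': "\<And>B. B \<in> P \<Longrightarrow> L' B \<in> fragment_class F S (enrich_alphabet P A)"
    and L: "L = (\<Union>B\<in>P. {w \<in> lists A. enrich_word P w \<in> L' B} \<inter> B)"
    unfolding enrichment_def by blast
  let ?T = "Label ` A \<union> (S \<union> MOD_sig) :: ('a, 'p) pred set"
  \<comment> \<open>The sentences of the \<open>L' B\<close> speak about enriched words, so here the
    enriched word is the source and the plain word is the target.\<close>
  let ?W = "(\<lambda>w. (w, enrich_word P w)) ` lists A"
  obtain d R where d: "\<And>B. B \<in> P \<Longrightarrow> d B > 1"
    and R: "\<And>B. B \<in> P \<Longrightarrow> B = {w \<in> lists A. length w mod d B \<in> R B}"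
    using MOD_class_residues P(3) by (metis subsetD)
  have tr: "\<exists>\<phi>'\<in>F ?T. free_vars \<phi>' = {} \<and>
      (\<forall>w\<in>lists A. sat w (\<lambda>_. 0) \<phi>' \<longleftrightarrow> enrich_word P w \<in> L' B)" if B: "B \<in> P" for B
  proof -
    obtain \<phi> where \<phi>: "\<phi> \<in> F (Label ` enrich_alphabet P A \<union> S)" "free_vars \<phi> = {}"
      and L'B: "L' B = lang_of (enrich_alphabet P A) \<phi>"
      using L'[OF B] unfolding fragment_class_def by blast
    have "\<exists>\<phi>'\<in>F ?T. free_vars \<phi>' = {} \<and> (\<forall>(u, w)\<in>?W. \<forall>e. sat u e \<phi>' = sat w e \<phi>)"
    proof (rule fragment_translation[OF F \<phi>])
      fix p :: "('a, 'p) pred" and xs :: "nat list"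
      assume p: "p \<in> Label ` enrich_alphabet P A \<union> S" and xs: "length xs = arity p"
      show "\<exists>\<psi>. quantifier_free \<psi> \<and> \<psi> \<in> formulas (set xs) ?T \<and>
        (\<forall>(u, w)\<in>?W. \<forall>e. e ` set xs \<subseteq> {..<length w} \<longrightarrow>
          sat u e \<psi> = holds p w (map e xs))"
      proof (cases "p \<in> S")
        case True
        \<comment> \<open>Enrichment preserves the length, so a structural atom is its own
          translation.\<close>
        then have "structural p" using S by (simp add: structural_sig_def)
        then show ?thesis
          using True xs by (intro exI[of _ "Atom p xs"])
            (auto dest: structural_holds[OF _ length_enrich_word])
      next
        case False
        then obtain C a where C: "C \<in> P" "a \<in> A" and p: "p = Label (tag C a)"
          using p by (auto simp: enrich_alphabet_def)
        obtain x where x: "xs = [x]"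
          using xs p by (auto simp: length_Suc_conv)
        \<comment> \<open>The letter \<open>tag C a\<close> at a position means that the label is
          \<open>a\<close> and that the prefix before the position lies in \<open>C\<close>. The
          second condition depends only on the length of that prefix.\<close>
        define \<psi> :: "('a, 'p) fm"
          where "\<psi> = And (Atom (Label a) [x]) (pos_residue_fm (d C) (R C) [x])"
        have "quantifier_free \<psi>" "\<psi> \<in> formulas (set xs) ?T"
          using C d pos_residue_fm(2)[of "d C" "R C" x "Label ` A \<union> S"]
          by (auto simp: \<psi>_def x pos_residue_fm(3) Un_assoc)
        moreover have "sat w e \<psi> \<longleftrightarrow> holds p (enrich_word P w) (map e xs)"
          if "w \<in> lists A" "e x < length w" for w e
        proof -
          \<comment> \<open>Positions count from 0, so the prefix before position \<open>e x\<close>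
            has length exactly \<open>e x\<close>, and the residue of the position itself is the one
            to test.\<close>
          have "take (e x) w \<in> C \<longleftrightarrow> e x mod d C \<in> R C"
            using that take_in_lists[OF that(1), of "e x"] by (subst R[OF C(1)]) simp
          then show ?thesis
            using that enrich_word_nth_eq_tag[OF A P(2) that(1) C(1) that(2)] d[OF C(1)]
            by (auto simp: \<psi>_def p x pos_residue_fm)
        qed
        ultimately show ?thesis
          by (intro exI[of _ \<psi>]) (auto simp: x)
      qed
    qed auto
    then obtain \<phi>' where \<phi>': "\<phi>' \<in> F ?T" "free_vars \<phi>' = {}"
      "\<And>w e. w \<in> lists A \<Longrightarrow> sat w e \<phi>' = sat (enrich_word P w) e \<phi>"
      by auto
    have "sat w (\<lambda>_. 0) \<phi>' \<longleftrightarrow> enrich_word P w \<in> L' B" if "w \<in> lists A" for w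
      unfolding L'B lang_of_def using \<phi>'(3)[OF that] enrich_word_in_lists[OF P(2) that] by simp
    with \<phi>'(1,2) show ?thesis by blast
  qed
  then obtain \<chi> where \<chi>: "\<And>B. B \<in> P \<Longrightarrow> \<chi> B \<in> F ?T" "\<And>B. B \<in> P \<Longrightarrow> free_vars (\<chi> B) = {}"
    "\<And>B w. B \<in> P \<Longrightarrow> w \<in> lists A \<Longrightarrow> sat w (\<lambda>_. 0) (\<chi> B) \<longleftrightarrow> enrich_word P w \<in> L' B"
    by metis
  obtain Bs where Bs: "set Bs = P" using finite_list[OF P(1)] by blast
  \<comment> \<open>The union over the blocks becomes a finite disjunction, in which the length
    formula expresses that the word lies in \<open>B\<close>.\<close>
  define \<Phi> where "\<Phi> = Disj (map (\<lambda>B. And (\<chi> B) (len_residue_fm (d B) (R B))) Bs)"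
  have "len_residue_fm (d B) (R B) \<in> F ?T" if "B \<in> P" for B
    using fragment_quantifier_free[OF F len_residue_fm(2,3)[OF d[OF that]], of _ "Label ` A \<union> S"]
    by (simp add: Un_assoc)
  then have "\<Phi> \<in> F ?T"
    unfolding \<Phi>_def using \<chi>(1) Bs by (auto intro!: fragment_Disj[OF F] fragment_And[OF F])
  moreover have "free_vars \<Phi> = {}"
    using \<chi>(2) Bs d by (auto simp: \<Phi>_def len_residue_fm(4))
  moreover have "L = lang_of A \<Phi>"
  proof -
    have "w \<in> B \<longleftrightarrow> length w mod d B \<in> R B" if "B \<in> P" "w \<in> lists A" for B w
      using that(2) by (subst R[OF that(1)]) simp
    then have "sat w (\<lambda>_. 0) \<Phi> \<longleftrightarrow> (\<exists>B\<in>P. enrich_word P w \<in> L' B \<and> w \<in> B)"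
      if "w \<in> lists A" for w
      unfolding \<Phi>_def using that \<chi>(3) Bs d by (simp add: len_residue_fm(1))
    then show ?thesis unfolding L lang_of_def by blast
  qed
  ultimately show "L \<in> fragment_class F (S \<union> MOD_sig) A"
    unfolding fragment_class_def by blast
qed

section \<open>Expressing modular predicates by the enrichment\<close>

lemma common_modulus:
  "\<exists>N>0. \<forall>(p, xs)\<in>atoms \<phi>. \<forall>d i. d > 1 \<longrightarrow> p = ModPos d i \<or> p = ModLen d i \<longrightarrow> d dvd N"
proof -
  \<comment> \<open>A formula has finitely many atoms, so its moduli above 1 form a finite set of
    positive numbers, and their product is a positive common multiple.\<close>
  define D where
    "D = {d. d > 1 \<and> (\<exists>i xs. (ModPos d i, xs) \<in> atoms \<phi> \<or> (ModLen d i, xs) \<in> atoms \<phi>)}"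
  have "D \<subseteq> (\<lambda>(p, xs). case p of ModPos d i \<Rightarrow> d | ModLen d i \<Rightarrow> d | _ \<Rightarrow> 0) ` atoms \<phi>"
    by (force simp: D_def image_iff)
  then have "finite D" by (rule finite_subset) (simp add: finite_atoms)
  then have "\<Prod>D > 0" "\<And>d. d \<in> D \<Longrightarrow> d dvd \<Prod>D"
    by (auto simp: D_def intro!: prod_pos dvd_prodI)
  then show ?thesis
    by (intro exI[of _ "\<Prod>D"]) (fastforce simp: D_def)
qed

text \<open>A partition has no empty block, so empty residue classes are removed. They arise when
  \<open>A\<close> is empty and the empty word is the only word.\<close>

definition residue_partition :: "nat \<Rightarrow> 'a letter set \<Rightarrow> 'a lang set" where
  "residue_partition N A = (\<lambda>m. {w \<in> lists A. length w mod N = m}) ` {..<N} - {{}}"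

lemma residue_partition:
  assumes "N > 0"
  shows "finite (residue_partition N A)" "partition_on (lists A) (residue_partition N A)"
    "residue_partition N A \<subseteq> MOD_class A"
proof -
  show "finite (residue_partition N A)"
    by (simp add: residue_partition_def)
  show "partition_on (lists A) (residue_partition N A)"
  proof (rule partition_onI)
    show "\<Union>(residue_partition N A) = lists A"
    proof (intro equalityI subsetI)
      fix w assume w: "w \<in> lists A"
      let ?B = "{v \<in> lists A. length v mod N = length w mod N}"
      have "w \<in> ?B" using w by simp
      moreover from this have "?B \<in> residue_partition N A"
        using assms unfolding residue_partition_def by (intro DiffI imageI) auto
      ultimately show "w \<in> \<Union>(residue_partition N A)" by (rule UnionI[rotated])
    qed (auto simp: residue_partition_def)
  qed (auto simp: residue_partition_def disjnt_def)
  show "residue_partition N A \<subseteq> MOD_class A"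
    using MOD_class.basic[of _ N A] by (auto simp: residue_partition_def)
qed

text \<open>The length modulo \<open>N\<close> is constant on a block and determines the length
  modulo every divisor of \<open>N\<close>.\<close>

lemma residue_partition_cong:
  assumes "B \<in> residue_partition N A" "d dvd N" "u \<in> B" "v \<in> B"
  shows "length u mod d = length v mod d"
  using assms unfolding residue_partition_def by (auto) (metis mod_mod_cancel)

text \<open>A single partition by the length modulo \<open>N\<close> serves the whole sentence. The
  translated sentence nevertheless varies with the block, since a length predicate is replaced by
  its truth value on that block.\<close>

lemma fragment_class_subset:
  fixes F :: "('a, 'p) pred set \<Rightarrow> ('a, 'p) fm set"
  assumes F: "fragment V F" and S: "structural_sig S" and A: "finite A"
  shows "fragment_class F (S \<union> MOD_sig) A \<subseteq> (fragment_class F S \<circ>\<^sub>e MOD_class) A"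
proof
  fix L assume "L \<in> fragment_class F (S \<union> MOD_sig) A"
  then obtain \<phi> where \<phi>: "\<phi> \<in> F (Label ` A \<union> (S \<union> MOD_sig))" "free_vars \<phi> = {}"
    and L: "L = lang_of A \<phi>"
    unfolding fragment_class_def by blast
  obtain N where N: "N > 0" and dvd: "\<And>p xs d i. (p, xs) \<in> atoms \<phi> \<Longrightarrow> d > 1 \<Longrightarrow>
      p = ModPos d i \<or> p = ModLen d i \<Longrightarrow> d dvd N"
    using common_modulus[of \<phi>] by blast
  define P where "P = residue_partition N A"
  note P = residue_partition[OF N, of A, folded P_def]
  let ?T = "Label ` enrich_alphabet P A \<union> S :: ('a, 'p) pred set"
  \<comment> \<open>There are finitely many pairs of a block and a letter, so any property
    \<open>Q\<close> of the pair found at a position is a disjunction of enriched labels. Label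
    atoms use a \<open>Q\<close> that ignores the block, position predicates one that ignores the
    letter.\<close>
  have labels: "\<exists>\<psi> :: ('a, 'p) fm. quantifier_free \<psi> \<and> \<psi> \<in> formulas {x} ?T \<and>
      (\<forall>w\<in>lists A. \<forall>e. e x < length w \<longrightarrow>
        sat (enrich_word P w) e \<psi> = Q (block P (take (e x) w)) (w ! e x))"
    for Q :: "'a lang \<Rightarrow> 'a letter \<Rightarrow> bool" and x
  proof -
    have "finite {(B, a) \<in> P \<times> A. Q B a}"
      by (rule finite_subset[of _ "P \<times> A"]) (use P(1) A in auto)
    then obtain Bas where Bas: "set Bas = {(B, a) \<in> P \<times> A. Q B a}"
      using finite_list by blast
    define \<psi> :: "('a, 'p) fm" where "\<psi> = Disj (map (\<lambda>(B, a). Atom (Label (tag B a)) [x]) Bas)"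
    have "quantifier_free \<psi>" "\<psi> \<in> formulas {x} ?T"
      using Bas by (auto simp: \<psi>_def enrich_alphabet_def intro!: imageI) blast
    moreover have "sat (enrich_word P w) e \<psi> = Q (block P (take (e x) w)) (w ! e x)"
      if w: "w \<in> lists A" and x: "e x < length w" for w e
    proof -
      note b = block_mem[OF P(2) take_in_lists[OF w, of "e x"]]
      have eq: "take (e x) w \<in> B \<longleftrightarrow> B = block P (take (e x) w)" if "B \<in> P" for B
        using b(2) block_eq[OF P(2) that] by metis
      have "w ! e x \<in> A"
        using w x by (simp add: in_lists_conv_set)
      have "sat (enrich_word P w) e \<psi> \<longleftrightarrow>
          (\<exists>B\<in>P. \<exists>a\<in>A. Q B a \<and> enrich_word P w ! e x = tag B a)"
        by (force simp: \<psi>_def Bas)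
      also have "\<dots> \<longleftrightarrow> (\<exists>B\<in>P. \<exists>a\<in>A. Q B a \<and> take (e x) w \<in> B \<and> w ! e x = a)"
        using enrich_word_nth_eq_tag[OF A P(2) w _ x] by auto
      also have "\<dots> \<longleftrightarrow> Q (block P (take (e x) w)) (w ! e x)"
        using eq b(1) \<open>w ! e x \<in> A\<close> by metis
      finally show ?thesis .
    qed
    ultimately show ?thesis by blast
  qed
  have tr: "\<exists>\<phi>'\<in>F ?T. free_vars \<phi>' = {} \<and>
      (\<forall>w\<in>B. \<forall>e. sat (enrich_word P w) e \<phi>' = sat w e \<phi>)" if B: "B \<in> P" for B
  proof -
    \<comment> \<open>Now the enriched word is the target. Only words of \<open>B\<close> are
      related, which makes every length predicate with a modulus dividing \<open>N\<close>
      constant.\<close>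
    let ?W = "(\<lambda>w. (enrich_word P w, w)) ` B"
    have BA: "B \<subseteq> lists A" using B P(2) by (auto dest: partition_onD1)
    have "\<exists>\<phi>'\<in>F ?T. free_vars \<phi>' = {} \<and> (\<forall>(u, w)\<in>?W. \<forall>e. sat u e \<phi>' = sat w e \<phi>)"
    proof (rule fragment_translation[OF F \<phi>])
      fix p :: "('a, 'p) pred" and xs :: "nat list"
      assume p: "p \<in> Label ` A \<union> (S \<union> MOD_sig)" and xs: "length xs = arity p"
        and at: "(p, xs) \<in> atoms \<phi>"
      consider (S) "p \<in> S" | (Label) a where "p = Label a"
        | (ModPos) d i where "p = ModPos d i" "d > 1"
        | (ModLen) d i where "p = ModLen d i" "d > 1"
        using p by (auto simp: MOD_sig_def)
      then have "\<exists>\<psi>. quantifier_free \<psi> \<and> \<psi> \<in> formulas (set xs) ?T \<and>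
        (\<forall>w\<in>B. \<forall>e. e ` set xs \<subseteq> {..<length w} \<longrightarrow>
          sat (enrich_word P w) e \<psi> = holds p w (map e xs))"
      proof cases
        case S
        then have "structural p" using S assms(2) by (simp add: structural_sig_def)
        then show ?thesis
          using S xs by (intro exI[of _ "Atom p xs"])
            (auto dest: structural_holds[OF _ length_enrich_word])
      next
        case (Label a)
        then obtain x where x: "xs = [x]" using xs by (auto simp: length_Suc_conv)
        show ?thesis
          using labels[of x "\<lambda>_ b. b = a"] BA by (auto simp: x Label) blast
      next
        case (ModPos d i)
        then obtain x where x: "xs = [x]" using xs by (auto simp: length_Suc_conv)
        have dN: "d dvd N" using dvd at ModPos by blast
        \<comment> \<open>The residue of a position is read off the block of its prefix as the
          residue shared by all words there. The prefix itself belongs to that block, so the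
          universal statement is not vacuous.\<close>
        have "(\<forall>u\<in>block P (take k w). length u mod d = i) \<longleftrightarrow> k mod d = i"
          if "w \<in> B" "k < length w" for w k
        proof -
          have "take k w \<in> lists A" using that(1) BA by (intro take_in_lists) auto
          note b = block_mem[OF P(2) this]
          have "length u mod d = k mod d" if "u \<in> block P (take k w)" for u
            using residue_partition_cong[OF b(1)[unfolded P_def] dN that[unfolded P_def]
                b(2)[unfolded P_def]] \<open>k < length w\<close> by simp
          with b(2) show ?thesis by auto
        qed
        then have block: "(\<forall>u\<in>block P (take (e x) w). length u mod d = i) \<longleftrightarrow>
            holds p w (map e xs)" if "w \<in> B" "e x < length w" for w e
          using that by (simp add: x ModPos)
        obtain \<psi> :: "('a, 'p) fm" where "quantifier_free \<psi>" "\<psi> \<in> formulas {x} ?T"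
          "\<And>w e. w \<in> lists A \<Longrightarrow> e x < length w \<Longrightarrow> sat (enrich_word P w) e \<psi> \<longleftrightarrow>
            (\<forall>u\<in>block P (take (e x) w). length u mod d = i)"
          using labels[of x "\<lambda>C _. \<forall>u\<in>C. length u mod d = i"] by blast
        then show ?thesis
          using block BA by (intro exI[of _ \<psi>]) (simp add: x subset_iff)
      next
        case (ModLen d i)
        have dN: "d dvd N" using dvd at ModLen by blast
        \<comment> \<open>The whole word lies in \<open>B\<close>, so the residue shared by the
          words of \<open>B\<close> decides between \<open>TT\<close> and \<open>FF\<close>.\<close>
        have "(\<forall>u\<in>B. length u mod d = i) \<longleftrightarrow> length w mod d = i" if "w \<in> B" for w
          using residue_partition_cong[OF B[unfolded P_def] dN _ that] that by metis
        then show ?thesis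
          by (intro exI[of _ "if \<forall>u\<in>B. length u mod d = i then TT else FF"]) (auto simp: ModLen)
      qed
      then show "\<exists>\<psi>. quantifier_free \<psi> \<and> \<psi> \<in> formulas (set xs) ?T \<and>
        (\<forall>(u, w)\<in>?W. \<forall>e. e ` set xs \<subseteq> {..<length w} \<longrightarrow>
          sat u e \<psi> = holds p w (map e xs))"
        by simp
    qed auto
    then show ?thesis by simp
  qed
  then obtain \<chi> where \<chi>: "\<And>B. B \<in> P \<Longrightarrow> \<chi> B \<in> F ?T" "\<And>B. B \<in> P \<Longrightarrow> free_vars (\<chi> B) = {}"
    "\<And>B w e. B \<in> P \<Longrightarrow> w \<in> B \<Longrightarrow> sat (enrich_word P w) e (\<chi> B) \<longleftrightarrow> sat w e \<phi>"
    by metis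
  define L' where "L' B = lang_of (enrich_alphabet P A) (\<chi> B)" for B
  have "L' B \<in> fragment_class F S (enrich_alphabet P A)" if "B \<in> P" for B
    using \<chi>(1,2) that unfolding L'_def fragment_class_def by blast
  moreover have "L = (\<Union>B\<in>P. {w \<in> lists A. enrich_word P w \<in> L' B} \<inter> B)"
  proof -
    \<comment> \<open>The translation is correct only on \<open>B\<close>. This suffices, because
      the enrichment intersects with \<open>B\<close> and the blocks cover all words.\<close>
    have eq: "w \<in> lists A \<and> enrich_word P w \<in> L' B \<longleftrightarrow> w \<in> L" if B: "B \<in> P" "w \<in> B" for B w
    proof -
      have "w \<in> lists A" using B partition_onD1[OF P(2)] by blast
      then show ?thesis
        using \<chi>(3)[OF B] enrich_word_in_lists[OF P(2)] by (simp add: L L'_def lang_of_def)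
    qed
    have "L \<subseteq> \<Union>P"
      using partition_onD1[OF P(2)] by (auto simp: L lang_of_def)
    then have "w \<in> L \<longleftrightarrow> (\<exists>B\<in>P. w \<in> L \<and> w \<in> B)" for w by blast
    moreover have "(\<exists>B\<in>P. w \<in> L \<and> w \<in> B) \<longleftrightarrow>
        (\<exists>B\<in>P. (w \<in> lists A \<and> enrich_word P w \<in> L' B) \<and> w \<in> B)" for w
      using eq by (intro bex_cong refl) metis
    ultimately show ?thesis by (intro set_eqI) simp
  qed
  ultimately show "L \<in> (fragment_class F S \<circ>\<^sub>e MOD_class) A"
    unfolding enrichment_def using P by blast
qed

theorem theorem4p13:
  fixes V :: "nat set"
    and F :: "('a, 'p) pred set \<Rightarrow> ('a, 'p) fm set"
    and S :: "('a, 'p) pred set"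
    and A :: "'a letter set"
  assumes "fragment V F"
    and "structural_sig S"
    and "finite A"
  shows "(fragment_class F S \<circ>\<^sub>e MOD_class) A = fragment_class F (S \<union> MOD_sig) A"
  using enrichment_subset[OF assms] fragment_class_subset[OF assms] by (rule equalityI)

end
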